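(* Let $r\in\mathbb{R}$ be a Liouville number and let $(p_m)_{m\ge 1}$, $(q_m)_{m\ge 1}$ be sequences of integers with $p_m\ge 2$, $q_m\ge 1$, such that $0<|rp_m-q_m|<p_m^{-m}$ for all $m\ge 1$ and $p_m^{-m}<|rp_{m-1}-q_{m-1}|$ for all $m\ge 2$. Let $h:\mathbb{T}^3\to\mathbb{R}^3$ be the vector field $$h(z)=\Bigl(r,\ 1,\ \sum_{m=1}^{\infty} m\,p_m^{-m+1}\cos\bigl(2\pi(z_1p_m-z_2q_m)\bigr)\Bigr).$$ Then the rotation vector of the initial value problem $\dot x=h(x)$, $x(0)=0$, exists in the weak sense and equals $\rho=(r,1,0)$.
   Context: $\mathbb{T}^3=\mathbb{R}^3/\mathbb{Z}^3$. A real number $r$ is called a Liouville number here if for each integer $n\ge 1$ there exist integers $p\ge 2$ and $q\ge 1$ with $0<|rp-q|<p^{-n}$. The vector field $h$ is identified with its $\mathbb{Z}^3$-periodic lift to $\mathbb{R}^3$, and the solution $x=(x_1,x_2,x_3):\mathbb{R}\to\mathbb{R}^3$ of the initial value problem is taken in $\mathbb{R}^3$ (i.e. it is a lift of the trajectory on the torus). For a lifted trajectory $X:\mathbb{R}\to\mathbb{R}^3$, the rotation vector exists in the weak sense if the limit $\rho:=\lim_{t\to\infty}\frac{X(t)-X(0)}{t}$ exists in $\mathbb{R}^3$; the rotation vector is then $\rho$. *)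

theory Defs
  imports "HOL-Analysis.Analysis"
begin

text \<open>
  The requirement \<open>q \<ge> 1\<close> makes every Liouville number in this sense positive.
\<close>
definition liouville_number :: "real \<Rightarrow> bool" where
  "liouville_number r \<longleftrightarrow>
     (\<forall>n::nat. n \<ge> 1 \<longrightarrow>
        (\<exists>p q::int. p \<ge> 2 \<and> q \<ge> 1 \<and>
           0 < \<bar>r * of_int p - of_int q\<bar> \<and>
           \<bar>r * of_int p - of_int q\<bar> < of_int p powi (- int n)))"

definition ivp_solution ::
    "('a::real_normed_vector \<Rightarrow> 'a) \<Rightarrow> 'a \<Rightarrow> (real \<Rightarrow> 'a) \<Rightarrow> bool" where
  "ivp_solution f x0 x \<longleftrightarrow>
     x 0 = x0 \<and> (\<forall>t. (x has_vector_derivative f (x t)) (at t))"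

definition has_weak_rotation_vector ::
    "(real \<Rightarrow> 'a::real_normed_vector) \<Rightarrow> 'a \<Rightarrow> bool" where
  "has_weak_rotation_vector X \<rho> \<longleftrightarrow>
     ((\<lambda>t. (X t - X 0) /\<^sub>R t) \<longlongrightarrow> \<rho>) at_top"

text \<open>
  Vector fields on the torus \<open>\<real>\<^sup>3 / \<int>\<^sup>3\<close> are represented by their periodic lifts.
\<close>
definition periodic_lift :: "(real ^ 3 \<Rightarrow> 'a) \<Rightarrow> bool" where
  "periodic_lift f \<longleftrightarrow> (\<forall>z k. (\<forall>i. k $ i \<in> \<int>) \<longrightarrow> f (z + k) = f z)"

definition field_term :: "(nat \<Rightarrow> int) \<Rightarrow> (nat \<Rightarrow> int) \<Rightarrow> real ^ 3 \<Rightarrow> nat \<Rightarrow> real" where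
  "field_term p q z m =
     of_nat m * of_int (p m) powi (- int m + 1) *
       cos (2 * pi * (z $ 1 * of_int (p m) - z $ 2 * of_int (q m)))"

text \<open>
  The series runs over \<open>m \<ge> 1\<close>, hence the shift; \<open>p 0\<close> and \<open>q 0\<close> are never used.
\<close>
definition torus_field :: "real \<Rightarrow> (nat \<Rightarrow> int) \<Rightarrow> (nat \<Rightarrow> int) \<Rightarrow> real ^ 3 \<Rightarrow> real ^ 3" where
  "torus_field r p q z = vector [r, 1, \<Sum>m. field_term p q z (Suc m)]"

lemma field_term_summable:
  assumes "\<And>m. m \<ge> 1 \<Longrightarrow> p m \<ge> 2"
  shows "summable (\<lambda>m. field_term p q z (Suc m))"
proof (rule summable_comparison_test')
  have "summable (\<lambda>m. of_nat (Suc m) * (1/2::real) ^ m)"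
    using geometric_deriv_sums[of "1/2::real"] by (simp add: sums_iff)
  then show "summable (\<lambda>m. real (Suc m) * (1/2) ^ m)" by simp
next
  fix m :: nat
  have p: "real_of_int (p (Suc m)) \<ge> 2"
    using assms[of "Suc m"] by linarith
  have "real_of_int (p (Suc m)) powi (- int (Suc m) + 1) = (1 / of_int (p (Suc m))) ^ m"
    by (simp add: power_int_minus power_divide divide_inverse power_inverse)
  also have "\<dots> \<le> (1/2) ^ m"
    using p by (intro power_mono) (auto simp: field_simps)
  finally have le: "real_of_int (p (Suc m)) powi (- int (Suc m) + 1) \<le> (1/2) ^ m" .
  have ge: "0 \<le> real_of_int (p (Suc m)) powi (- int (Suc m) + 1)"
    using p by simp
  have "\<bar>field_term p q z (Suc m)\<bar> \<le>
      real (Suc m) * of_int (p (Suc m)) powi (- int (Suc m) + 1) * 1"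
    unfolding field_term_def abs_mult using ge by (intro mult_mono) (auto simp: abs_mult)
  also have "\<dots> \<le> real (Suc m) * (1/2) ^ m"
    using le by (simp add: mult_left_mono del: of_nat_Suc)
  finally show "norm (field_term p q z (Suc m)) \<le> real (Suc m) * (1/2) ^ m"
    by simp
qed

lemma periodic_lift_torus_field: "periodic_lift (torus_field r p q)"
  unfolding periodic_lift_def
proof (intro allI impI)
  fix z k :: "real ^ 3"
  assume k: "\<forall>i. k $ i \<in> \<int>"
  have "field_term p q (z + k) m = field_term p q z m" for m
  proof -
    obtain a b where ab: "k $ 1 = of_int a" "k $ 2 = of_int b"
      using k by (meson Ints_cases)
    have "2 * pi * ((z + k) $ 1 * of_int (p m) - (z + k) $ 2 * of_int (q m)) =
        2 * pi * (z $ 1 * of_int (p m) - z $ 2 * of_int (q m)) +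
        2 * pi * of_int (a * p m - b * q m)"
      by (simp add: ab algebra_simps)
    then show ?thesis
      unfolding field_term_def
      by (simp only: cos_add cos_int_2pin sin_int_2pin) simp
  qed
  then show "torus_field r p q (z + k) = torus_field r p q z"
    by (simp add: torus_field_def)
qed

end

theory Submission
  imports Defs
begin

text \<open>
  The first two components of the solution are \<open>r t\<close> and \<open>t\<close>, so the third velocity is an almost
  periodic function of time, \<open>\<Sum>m. c m * cos (\<omega> m * t)\<close>, with absolutely summable amplitudes and
  nonzero frequencies. Its primitive is \<open>\<Sum>m. c m * (sin (\<omega> m * t) / \<omega> m)\<close>. After division by \<open>t\<close>
  every term tends to 0 and is dominated by \<open>\<bar>c m\<bar>\<close>, so Tannery's theorem gives mean velocity 0.
\<close>

lemma has_vector_derivative_vecI: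
  fixes f :: "real \<Rightarrow> real ^ 'n"
  assumes "\<And>i. ((\<lambda>t. f t $ i) has_real_derivative f' $ i) (at t within S)"
  shows "(f has_vector_derivative f') (at t within S)"
  unfolding has_vector_derivative_def
  by (subst has_derivative_componentwise_within)
    (use assms in \<open>auto simp: Basis_vec_def inner_axis has_field_derivative_def mult_commute_abs\<close>)

lemma has_vector_derivative_vec_nth:
  fixes f :: "real \<Rightarrow> real ^ 'n"
  assumes "(f has_vector_derivative f') F"
  shows "((\<lambda>t. f t $ i) has_real_derivative f' $ i) F"
  using bounded_linear.has_vector_derivative[OF bounded_linear_vec_nth assms]
  by (simp add: has_real_derivative_iff_has_vector_derivative)

text \<open>Gives uniqueness for the initial value problem without a Lipschitz estimate: two
  solutions will turn out to have the same velocity as a function of time.\<close>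

lemma vector_derivative_eq_imp_eq:
  fixes f g :: "real \<Rightarrow> 'a::real_normed_vector"
  assumes "\<And>t. (f has_vector_derivative f' t) (at t)"
    and "\<And>t. (g has_vector_derivative f' t) (at t)"
    and "f a = g a"
  shows "f = g"
proof
  fix t
  have "((\<lambda>t. f t - g t) has_vector_derivative 0) (at t within UNIV)" for t
    using has_vector_derivative_diff[OF assms(1,2)] by simp
  then obtain c where "\<And>t. f t - g t = c"
    using has_vector_derivative_zero_constant[of UNIV "\<lambda>t. f t - g t"] by auto
  then have "f t - g t = f a - g a" by simp
  with assms(3) show "f t = g t" by simp
qed

definition cos_series_primitive :: "(nat \<Rightarrow> real) \<Rightarrow> (nat \<Rightarrow> real) \<Rightarrow> real \<Rightarrow> real" where
  "cos_series_primitive c \<omega> t = (\<Sum>n. c n * (sin (\<omega> n * t) / \<omega> n))"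

lemma cos_series_primitive_0 [simp]: "cos_series_primitive c \<omega> 0 = 0"
  by (simp add: cos_series_primitive_def)

context
  fixes c \<omega> :: "nat \<Rightarrow> real"
  assumes summable: "summable (\<lambda>n. \<bar>c n\<bar>)" and nonzero: "\<And>n. \<omega> n \<noteq> 0"
begin

lemma has_derivative_cos_series_primitive:
  "(cos_series_primitive c \<omega> has_real_derivative (\<Sum>n. c n * cos (\<omega> n * t))) (at t)"
  unfolding cos_series_primitive_def[abs_def]
\<comment> \<open>Termwise differentiation needs uniform convergence of the differentiated series
  only; the series itself must converge at one point, and at 0 all its terms vanish.\<close>
proof (rule has_field_derivative_series'(2)[where S = UNIV and ?x0.0 = 0])
  show "uniformly_convergent_on UNIV (\<lambda>n x. \<Sum>i<n. c i * cos (\<omega> i * x))"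
    by (rule Weierstrass_m_test'[OF _ summable]) (auto simp: abs_mult mult_left_le)
  show "((\<lambda>t. c n * (sin (\<omega> n * t) / \<omega> n)) has_real_derivative c n * cos (\<omega> n * x)) (at x)" for n x
    using nonzero[of n] by (auto intro!: derivative_eq_intros)
qed auto

text \<open>The estimate \<bar>sin x\<bar> \<le> \<bar>x\<bar> cancels the small denominator
  \<open>\<omega> n\<close>. Bounding the sine by 1 would leave \<open>c n / \<omega> n\<close>,
  which need not be summable.\<close>

lemma norm_cos_series_primitive_term_le:
  "norm (c n * (sin (\<omega> n * t) / \<omega> n)) \<le> \<bar>c n\<bar> * \<bar>t\<bar>"
proof -
  have "\<bar>sin (\<omega> n * t)\<bar> / \<bar>\<omega> n\<bar> \<le> \<bar>t\<bar>"
    using abs_sin_x_le_abs_x[of "\<omega> n * t"] nonzero[of n] by (simp add: abs_mult field_simps)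
  then show ?thesis
    by (simp only: real_norm_def abs_mult abs_divide) (rule mult_left_mono, auto)
qed

lemma cos_series_primitive_over_tendsto_0:
  "((\<lambda>t. cos_series_primitive c \<omega> t / t) \<longlongrightarrow> 0) at_top"
proof -
  let ?a = "\<lambda>n t. c n * (sin (\<omega> n * t) / \<omega> n) / t"
  \<comment> \<open>For a single \<open>n\<close> the crude bound by 1 on the sine suffices, since
    the constant may depend on \<open>n\<close>.\<close>
  have lim: "(?a n \<longlongrightarrow> 0) at_top" for n
  proof (rule Lim_null_comparison)
    show "\<forall>\<^sub>F t in at_top. norm (?a n t) \<le> \<bar>c n / \<omega> n\<bar> / t"
      using eventually_gt_at_top[of 0]
      by eventually_elim (auto simp: abs_mult intro!: divide_right_mono mult_left_le)
    show "((\<lambda>t. \<bar>c n / \<omega> n\<bar> / t) \<longlongrightarrow> 0) at_top"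
      by (intro tendsto_divide_0[OF tendsto_const] filterlim_at_top_imp_at_infinity filterlim_ident)
  qed
  have bound: "norm (?a n t) \<le> \<bar>c n\<bar>" if "t > 0" for n t
    using norm_cos_series_primitive_term_le[of n t] that
    by (simp only: norm_divide) (simp only: real_norm_def abs_of_pos pos_divide_le_eq)
  have "\<forall>\<^sub>F (n, t) in at_top \<times>\<^sub>F at_top. norm (?a n t) \<le> \<bar>c n\<bar>"
    by (rule eventually_mono[OF eventually_prodI[of "\<lambda>_. True" at_top, OF _ eventually_gt_at_top[of "0::real"]]])
      (use bound in auto)
  from tannerys_theorem[OF lim this summable]
  have "((\<lambda>t. \<Sum>n. ?a n t) \<longlongrightarrow> 0) at_top"
    by simp
  \<comment> \<open>Moving the division inside the sum requires summability at each fixed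
    \<open>t\<close>, which the bound linear in \<bar>t\<bar> supplies.\<close>
  moreover have "cos_series_primitive c \<omega> t / t = (\<Sum>n. ?a n t)" for t
    unfolding cos_series_primitive_def
    by (intro suminf_divide[symmetric] summable_comparison_test'[OF summable_mult2[OF summable, of "\<bar>t\<bar>"]]
        norm_cos_series_primitive_term_le)
  ultimately show ?thesis by simp
qed

end

theorem proposition4:
  fixes r :: real and p q :: "nat \<Rightarrow> int" and h :: "real ^ 3 \<Rightarrow> real ^ 3"
  assumes "liouville_number r"
    and "\<And>m. m \<ge> 1 \<Longrightarrow> p m \<ge> 2"
    and "\<And>m. m \<ge> 1 \<Longrightarrow> q m \<ge> 1"
    and "\<And>m. m \<ge> 1 \<Longrightarrow> 0 < \<bar>r * of_int (p m) - of_int (q m)\<bar>"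
    and "\<And>m. m \<ge> 1 \<Longrightarrow>
           \<bar>r * of_int (p m) - of_int (q m)\<bar> < of_int (p m) powi (- int m)"
    and "\<And>m. m \<ge> 2 \<Longrightarrow>
           of_int (p m) powi (- int m) < \<bar>r * of_int (p (m - 1)) - of_int (q (m - 1))\<bar>"
    and "h = torus_field r p q"
  shows "(\<exists>!x. ivp_solution h 0 x) \<and>
         (\<forall>x. ivp_solution h 0 x \<longrightarrow> has_weak_rotation_vector x (vector [r, 1, 0]))"
proof -
  define c where "c n = of_nat (Suc n) * real_of_int (p (Suc n)) powi (- int (Suc n) + 1)" for n
  define \<omega> where "\<omega> n = 2 * pi * (r * of_int (p (Suc n)) - of_int (q (Suc n)))" for n
  define F where "F = cos_series_primitive c \<omega>"
  define X :: "real \<Rightarrow> real ^ 3" where "X t = vector [r * t, t, F t]" for t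
  have "c n \<ge> 0" for n
    using assms(2)[of "Suc n"] by (simp add: c_def)
  \<comment> \<open>At the origin every cosine is 1, so summability of the amplitudes is the
    convergence of the field's series there.\<close>
  moreover have "field_term p q 0 (Suc n) = c n" for n
    by (simp add: field_term_def c_def)
  ultimately have summable: "summable (\<lambda>n. \<bar>c n\<bar>)"
    using field_term_summable[of p q 0, OF assms(2)] by simp
  \<comment> \<open>Absence of resonance: a zero frequency would contribute \<open>c n\<close> to
    the mean velocity.\<close>
  have nonzero: "\<omega> n \<noteq> 0" for n
    using assms(4)[of "Suc n"] by (simp add: \<omega>_def)
  \<comment> \<open>The third coordinate of \<open>z\<close> stays free, so this applies to an
    arbitrary solution as well as to \<open>X\<close>.\<close>
  have h_eq: "h z = vector [r, 1, \<Sum>n. c n * cos (\<omega> n * t)]" if "z $ 1 = r * t" "z $ 2 = t" for z t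
    using that by (simp add: assms(7) torus_field_def field_term_def c_def \<omega>_def algebra_simps)
  have F': "(F has_real_derivative (\<Sum>n. c n * cos (\<omega> n * t))) (at t)" for t
    unfolding F_def by (rule has_derivative_cos_series_primitive[OF summable nonzero])
  have X0: "X 0 = 0"
    by (simp add: X_def F_def vec_eq_iff forall_3)
  have X': "(X has_vector_derivative h (X t)) (at t)" for t
  proof (rule has_vector_derivative_vecI)
    have "\<forall>i. ((\<lambda>t. X t $ i) has_real_derivative h (X t) $ i) (at t)"
      using F' by (auto simp: forall_3 X_def h_eq[of _ t] intro!: derivative_eq_intros)
    then show "((\<lambda>t. X t $ i) has_real_derivative h (X t) $ i) (at t)" for i ..
  qed
  have unique: "x = X" if "ivp_solution h 0 x" for x
  proof -
    have x0: "x 0 = 0" and x': "\<And>t. (x has_vector_derivative h (x t)) (at t)"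
      using that by (auto simp: ivp_solution_def)
    have "(\<lambda>t. x t $ 1) = (\<lambda>t. r * t)"
      by (rule vector_derivative_eq_imp_eq[where f' = "\<lambda>_. r" and a = 0])
        (use has_vector_derivative_vec_nth[OF x', of 1] in
          \<open>auto simp: x0 assms(7) torus_field_def
            simp flip: has_real_derivative_iff_has_vector_derivative intro!: derivative_eq_intros\<close>)
    moreover have "(\<lambda>t. x t $ 2) = (\<lambda>t. t)"
      by (rule vector_derivative_eq_imp_eq[where f' = "\<lambda>_. 1" and a = 0])
        (use has_vector_derivative_vec_nth[OF x', of 2] in
          \<open>auto simp: x0 assms(7) torus_field_def
            simp flip: has_real_derivative_iff_has_vector_derivative intro!: derivative_eq_intros\<close>)
    \<comment> \<open>The field does not depend on the third coordinate, so the velocities agree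
      before anything is known about \<open>x t $ 3\<close>.\<close>
    ultimately have "h (x t) = h (X t)" for t
      using h_eq[of "x t" t] h_eq[of "X t" t] by (simp add: X_def fun_eq_iff)
    with x' have "(x has_vector_derivative h (X t)) (at t)" for t
      by simp
    then show ?thesis
      using X' by (rule vector_derivative_eq_imp_eq[where a = 0]) (simp add: x0 X0)
  qed
  have "has_weak_rotation_vector X (vector [r, 1, 0])"
    unfolding has_weak_rotation_vector_def
  proof (rule vec_tendstoI)
    have "((\<lambda>t. inverse t * (a * t)) \<longlongrightarrow> a) at_top" for a :: real
      by (rule tendsto_eventually, rule eventually_mono[OF eventually_gt_at_top[of 0]]) auto
    from this[of r] this[of 1] cos_series_primitive_over_tendsto_0[OF summable nonzero]
    have "\<forall>i. ((\<lambda>t. ((X t - X 0) /\<^sub>R t) $ i) \<longlongrightarrow> vector [r, 1, 0] $ i) at_top"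
      by (simp add: forall_3 X_def F_def divide_inverse_commute)
    then show "((\<lambda>t. ((X t - X 0) /\<^sub>R t) $ i) \<longlongrightarrow> vector [r, 1, 0] $ i) at_top" for i ..
  qed
  moreover have "ivp_solution h 0 X"
    using X0 X' by (simp add: ivp_solution_def)
  ultimately show ?thesis
    using unique by blast
qed

end
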